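(* If $(G,\mathfrak S)$ is a hierarchically hyperbolic group such that, for every $U\in\mathfrak S$, the subgroup $\operatorname{Stab}_G(U)$ is separable in $G$ and acts cocompactly on the standard product region $P_U$, then $G$ has a finite-index subgroup that admits a BBF colouring.
   Context: HIERARCHICALLY HYPERBOLIC GROUPS. A hierarchically hyperbolic group (HHG) $(G,\mathfrak S)$ with constant $E$ consists of a finitely generated group $G$, with the word metric $\mathsf d_G$ of a fixed finite generating set, and a set $\mathfrak S$ of domains, such that the following hold. (1) Projections: each $U\in\mathfrak S$ has an $E$-hyperbolic geodesic space $\mathcal C U$ and an $(E,E)$-coarsely Lipschitz, $E$-coarsely onto coarse map $\pi_U:G\to\mathcal C U$ (points may be sent to nonempty sets of diameter at most $E$). Write $\mathsf d_U(x,y)=\mathsf d_{\mathcal C U}(\pi_U(x),\pi_U(y))$ for points or subsets $x,y$ of $G$, and $\mathsf d_U(x,b)=\mathsf d_{\mathcal C U}(\pi_U(x),b)$ for $b\subset\mathcal C U$. (2) Nesting: $\mathfrak S$ has a partial order $\sqsubseteq$ with a unique maximal element; $U\sqsubset V$ means $U\sqsubseteq V$ and $U\ne V$. If $U\sqsubset V$ there are a specified nonempty set $\rho^U_V\subset\mathcal C V$ of diameter at most $E$ and a coarse map $\rho^V_U:\mathcal C V\to\mathcal C U$. (3) Orthogonality: $\bot$ is a symmetric antireflexive relation on $\mathfrak S$; if $V\sqsubseteq W$ and $W\bot U$ then $V\bot U$; if $V\bot W$ then $V,W$ are not $\sqsubseteq$-comparable; for all $T\in\mathfrak S$ and $U\sqsubseteq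 T$ such that some $V\sqsubseteq T$ has $V\bot U$, there is $W\sqsubset T$ such that every $V\sqsubseteq T$ with $V\bot U$ satisfies $V\sqsubseteq W$. (4) Transversality and consistency: $U\pitchfork V$ (transverse) means $U,V$ are neither $\sqsubseteq$-comparable nor orthogonal; then there are specified nonempty sets $\rho^U_V\subset\mathcal C V$, $\rho^V_U\subset\mathcal C U$ of diameter at most $E$, with $\min\{\mathsf d_U(x,\rho^V_U),\mathsf d_V(x,\rho^U_V)\}\le E$ for all $x\in G$. If $U\sqsubset V$ then $\min\{\mathsf d_V(x,\rho^U_V),\operatorname{diam}(\pi_U(x)\cup\rho^V_U(\pi_V(x)))\}\le E$ for all $x\in G$. If $U\sqsubseteq V$ then $\mathsf d_{\mathcal C W}(\rho^U_W,\rho^V_W)\le E$ whenever $V\sqsubset W$, or $V\pitchfork W$ and $W\not\perp U$. (5) Finite complexity: $\sqsubset$-chains have uniformly bounded length. (6) Large links: there is $\lambda_0\ge1$ such that for $W\in\mathfrak S$, $x,x'\in G$ and $N=\lambda_0\mathsf d_W(x,x')+\lambda_0$, there are $T_1,\dots,T_{\lfloor N\rfloor}\sqsubset W$ such that every $T\sqsubset W$ satisfies $T\sqsubseteq T_j$ for some $j$ or $\mathsf d_T(x,x')<E$, and $\mathsf d_W(x,\rho^{T_j}_W)\le N$ for all $j$. (7) Bounded geodesic image: if $V\sqsubset W$ and $\gamma$ is a geodesic in $\mathcal C W$, then $\operatorname{diam}\rho^W_V(\gamma)\le E$ or $\gamma$ meets the $E$-neighbourhood of $\rho^V_W$. (8)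 Partial realisation: if $\{V_j\}$ are pairwise orthogonal and $p_j\in\pi_{V_j}(G)$, there is $x\in G$ with $\mathsf d_{V_j}(x,p_j)\le E$ for all $j$, and $\mathsf d_V(x,\rho^{V_j}_V)\le E$ whenever $V_j\sqsubset V$ or $V\pitchfork V_j$. (9) Uniqueness: there is a function $E:[0,\infty)\to[0,\infty)$ (with $E=E(0)$) such that if $\mathsf d_V(x,y)<\kappa$ for all $V\in\mathfrak S$ then $\mathsf d_G(x,y)<E(\kappa)$. (10) $G$ acts on $\mathfrak S$ with finitely many orbits, preserving $\sqsubseteq,\bot,\pitchfork$; each $g\in G$ has isometries $g:\mathcal C U\to\mathcal C gU$ ($U\in\mathfrak S$) such that the isometry of a product $g_1g_2$ is the composition of those of $g_1$ and $g_2$, and $g\pi_U(x)=\pi_{gU}(gx)$, $g\rho^U_V=\rho^{gU}_{gV}$ whenever $x\in G$ and $U\sqsubset V$ or $U\pitchfork V$. BBF COLOURING. A BBF colouring of $(G,\mathfrak S)$ is a decomposition $\mathfrak S=\bigsqcup_{i=1}^\chi\mathfrak S_i$ into finitely many $G$-invariant subsets such that any two distinct domains in the same $\mathfrak S_i$ are transverse. A finite-index subgroup $G'\le G$ is an HHG with the same structure $\mathfrak S$; it admits a BBF colouring if there is such a decomposition of $\mathfrak S$ into finitely many $G'$-invariant subsets. STANDARD PRODUCT REGIONS. For $U\in\mathfrak S$, $P_U=\{x\in G:\mathsf d_V(x,\rho^U_V)\le E\text{ for all }V\in\mathfrak S\text{ with }V\pitchfork U\text{ or }U\sqsubset V\}$.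 It is nonempty, $gP_U=P_{gU}$, and $\operatorname{Stab}_G(U)=\{g\in G:gU=U\}$ acts on $P_U$ by left multiplication; the action is cocompact if $P_U$ is covered by finitely many $\operatorname{Stab}_G(U)$-orbits of points. A subgroup $H\le G$ is separable if it is an intersection of finite-index subgroups of $G$. *)

theory Defs
  imports "HOL-Analysis.Abstract_Metric_Spaces" "HOL-Algebra.Group_Action"
    "HOL-Algebra.Generated_Groups"
begin

section \<open>Metric notions\<close>

text \<open>Infimal distance between subsets; it is only applied to nonempty sets.\<close>

definition set_dist :: "'c metric \<Rightarrow> 'c set \<Rightarrow> 'c set \<Rightarrow> real" where
  "set_dist m A B = Inf {mdist m a b | a b. a \<in> A \<and> b \<in> B}"

text \<open>The diameter of \<open>A\<close> is at most \<open>r\<close>.\<close>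

definition diam_le :: "'c metric \<Rightarrow> 'c set \<Rightarrow> real \<Rightarrow> bool" where
  "diam_le m A r \<longleftrightarrow> (\<forall>a\<in>A. \<forall>b\<in>A. mdist m a b \<le> r)"

text \<open>Possible values of coarse maps, and the specified subsets \<open>\<rho>\<close>.\<close>

definition coarse_point :: "'c metric \<Rightarrow> real \<Rightarrow> 'c set \<Rightarrow> bool" where
  "coarse_point m r A \<longleftrightarrow> A \<subseteq> mspace m \<and> A \<noteq> {} \<and> diam_le m A r"

definition geodesic_between :: "'c metric \<Rightarrow> 'c \<Rightarrow> 'c \<Rightarrow> 'c set \<Rightarrow> bool" where
  "geodesic_between m x y A \<longleftrightarrow>
     (\<exists>(\<gamma> :: real \<Rightarrow> 'c) L. 0 \<le> L \<and> \<gamma> ` {0..L} \<subseteq> mspace m \<and> \<gamma> 0 = x \<and> \<gamma> L = y \<and>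
        (\<forall>s\<in>{0..L}. \<forall>t\<in>{0..L}. mdist m (\<gamma> s) (\<gamma> t) = \<bar>s - t\<bar>) \<and> A = \<gamma> ` {0..L})"

definition geodesic_segment :: "'c metric \<Rightarrow> 'c set \<Rightarrow> bool" where
  "geodesic_segment m A \<longleftrightarrow> (\<exists>x y. geodesic_between m x y A)"

definition geodesic_space :: "'c metric \<Rightarrow> bool" where
  "geodesic_space m \<longleftrightarrow> (\<forall>x\<in>mspace m. \<forall>y\<in>mspace m. \<exists>A. geodesic_between m x y A)"

text \<open>Rips' thin triangles condition. Permuting the vertices covers the other two sides.\<close>

definition hyperbolic_space :: "real \<Rightarrow> 'c metric \<Rightarrow> bool" where
  "hyperbolic_space \<delta> m \<longleftrightarrow>
     (\<forall>x y z A B C. geodesic_between m x y A \<and> geodesic_between m y z B \<and> geodesic_between m x z C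
        \<longrightarrow> (\<forall>p\<in>A. set_dist m {p} (B \<union> C) \<le> \<delta>))"

section \<open>Group notions\<close>

definition word_length :: "('g, 'x) monoid_scheme \<Rightarrow> 'g set \<Rightarrow> 'g \<Rightarrow> nat" where
  "word_length G X g = (LEAST n. \<exists>ws. length ws = n \<and> set ws \<subseteq> X \<union> (\<lambda>s. inv\<^bsub>G\<^esub> s) ` X \<and>
     foldr (\<lambda>a b. a \<otimes>\<^bsub>G\<^esub> b) ws \<one>\<^bsub>G\<^esub> = g)"

definition word_dist :: "('g, 'x) monoid_scheme \<Rightarrow> 'g set \<Rightarrow> 'g \<Rightarrow> 'g \<Rightarrow> real" where
  "word_dist G X g h = real (word_length G X (inv\<^bsub>G\<^esub> g \<otimes>\<^bsub>G\<^esub> h))"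

definition finite_index_subgroup :: "'g set \<Rightarrow> ('g, 'x) monoid_scheme \<Rightarrow> bool" where
  "finite_index_subgroup K G \<longleftrightarrow> subgroup K G \<and> finite (rcosets\<^bsub>G\<^esub> K)"

text \<open>The family is required to be nonempty because \<open>\<Inter>{}\<close> is the whole type; the group itself is
  of finite index, so this excludes nothing.\<close>

definition separable_subgroup :: "'g set \<Rightarrow> ('g, 'x) monoid_scheme \<Rightarrow> bool" where
  "separable_subgroup H G \<longleftrightarrow> subgroup H G \<and>
     (\<exists>\<F>. \<F> \<noteq> {} \<and> (\<forall>K\<in>\<F>. finite_index_subgroup K G) \<and> H = \<Inter>\<F>)"

section \<open>Hierarchically hyperbolic groups\<close>

text \<open>
  The fields of the structure \<open>\<SS>\<close> are read as follows.
    \<^item> \<open>domains \<SS>\<close> is the index set, and \<open>cspace \<SS> U\<close> is the hyperbolic space of \<open>U\<close>.  Using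
      one point type for all of these spaces is no restriction, as they embed in their disjoint union.
    \<^item> \<open>proj \<SS> U x\<close> is the subset \<open>\<pi>\<^sub>U(x)\<close> of \<open>cspace \<SS> U\<close>.
    \<^item> \<open>rho \<SS> U V\<close> is the subset \<open>\<rho>\<close> of \<open>cspace \<SS> V\<close> (upper index \<open>U\<close>, lower index \<open>V\<close>), for \<open>U\<close>
      properly nested in \<open>V\<close> or transverse to \<open>V\<close>.
    \<^item> \<open>rho_map \<SS> V U\<close> is the coarse map \<open>\<rho>\<close> from \<open>cspace \<SS> V\<close> to \<open>cspace \<SS> U\<close> (upper index \<open>V\<close>,
      lower index \<open>U\<close>), for \<open>U\<close> properly nested in \<open>V\<close>.
    \<^item> \<open>dom_act \<SS> g\<close> is the action of \<open>g\<close> on the domains, and \<open>isom \<SS> g U\<close> is the isometry from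
      \<open>cspace \<SS> U\<close> to \<open>cspace \<SS> (dom_act \<SS> g U)\<close>.
\<close>

record ('g, 'd, 'c) hh_structure =
  domains :: "'d set"
  cspace :: "'d \<Rightarrow> 'c metric"
  proj :: "'d \<Rightarrow> 'g \<Rightarrow> 'c set"
  nest :: "'d \<Rightarrow> 'd \<Rightarrow> bool"
  orth :: "'d \<Rightarrow> 'd \<Rightarrow> bool"
  rho :: "'d \<Rightarrow> 'd \<Rightarrow> 'c set"
  rho_map :: "'d \<Rightarrow> 'd \<Rightarrow> 'c \<Rightarrow> 'c set"
  dom_act :: "'g \<Rightarrow> 'd \<Rightarrow> 'd"
  isom :: "'g \<Rightarrow> 'd \<Rightarrow> 'c \<Rightarrow> 'c"

definition pnest :: "('g, 'd, 'c) hh_structure \<Rightarrow> 'd \<Rightarrow> 'd \<Rightarrow> bool" where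
  "pnest \<SS> U V \<longleftrightarrow> nest \<SS> U V \<and> U \<noteq> V"

definition transverse :: "('g, 'd, 'c) hh_structure \<Rightarrow> 'd \<Rightarrow> 'd \<Rightarrow> bool" where
  "transverse \<SS> U V \<longleftrightarrow> \<not> nest \<SS> U V \<and> \<not> nest \<SS> V U \<and> \<not> orth \<SS> U V"

text \<open>\<open>dist_at \<SS> U x x'\<close> and \<open>dist_to \<SS> U x b\<close> are \<open>d\<^sub>U(x,x')\<close> and \<open>d\<^sub>U(x,b)\<close>, for points \<open>x\<close>, \<open>x'\<close> of
  the group and a subset \<open>b\<close> of \<open>cspace \<SS> U\<close>.\<close>

definition dist_at :: "('g, 'd, 'c) hh_structure \<Rightarrow> 'd \<Rightarrow> 'g \<Rightarrow> 'g \<Rightarrow> real" where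
  "dist_at \<SS> U x x' = set_dist (cspace \<SS> U) (proj \<SS> U x) (proj \<SS> U x')"

definition dist_to :: "('g, 'd, 'c) hh_structure \<Rightarrow> 'd \<Rightarrow> 'g \<Rightarrow> 'c set \<Rightarrow> real" where
  "dist_to \<SS> U x b = set_dist (cspace \<SS> U) (proj \<SS> U x) b"

text \<open>
  Two readings in the following axioms:
    \<^item> in \<open>large_links\<close> the list of domains is a set of \<^emph>\<open>at most\<close> \<open>\<lfloor>N\<rfloor>\<close> domains, as it has to be empty
      when \<open>W\<close> is minimal for nesting;
    \<^item> in \<open>bounded_geodesic_image\<close> geodesics are geodesic segments; the statement for infinite
      geodesics follows by exhausting them by segments.
\<close>

locale hierarchically_hyperbolic_group = group G
  for G :: "('g, 'x) monoid_scheme" (structure) +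
  fixes X :: "'g set" and \<SS> :: "('g, 'd, 'c) hh_structure" and E :: real
  assumes generators: "finite X" "X \<subseteq> carrier G" "generate G X = carrier G"
      \<comment> \<open>projections\<close>
    and hyperbolic_spaces:
      "\<And>U. U \<in> domains \<SS> \<Longrightarrow> geodesic_space (cspace \<SS> U) \<and> hyperbolic_space E (cspace \<SS> U)"
    and proj_coarse_map:
      "\<And>U x. \<lbrakk>U \<in> domains \<SS>; x \<in> carrier G\<rbrakk> \<Longrightarrow> coarse_point (cspace \<SS> U) E (proj \<SS> U x)"
    and proj_coarsely_Lipschitz:
      "\<And>U x y. \<lbrakk>U \<in> domains \<SS>; x \<in> carrier G; y \<in> carrier G\<rbrakk> \<Longrightarrow>
         dist_at \<SS> U x y \<le> E * word_dist G X x y + E"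
    and proj_coarsely_onto:
      "\<And>U p. \<lbrakk>U \<in> domains \<SS>; p \<in> mspace (cspace \<SS> U)\<rbrakk> \<Longrightarrow>
         set_dist (cspace \<SS> U) {p} (\<Union>x\<in>carrier G. proj \<SS> U x) \<le> E"
      \<comment> \<open>nesting\<close>
    and nest_partial_order:
      "reflp_on (domains \<SS>) (nest \<SS>)" "antisymp_on (domains \<SS>) (nest \<SS>)"
      "transp_on (domains \<SS>) (nest \<SS>)"
    and nest_unique_maximal:
      "\<exists>!M. M \<in> domains \<SS> \<and> (\<forall>V\<in>domains \<SS>. \<not> pnest \<SS> M V)"
    and nest_rho:
      "\<And>U V. \<lbrakk>U \<in> domains \<SS>; V \<in> domains \<SS>; pnest \<SS> U V\<rbrakk> \<Longrightarrow>
         coarse_point (cspace \<SS> V) E (rho \<SS> U V)"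
    and nest_rho_map:
      "\<And>U V p. \<lbrakk>U \<in> domains \<SS>; V \<in> domains \<SS>; pnest \<SS> U V; p \<in> mspace (cspace \<SS> V)\<rbrakk> \<Longrightarrow>
         coarse_point (cspace \<SS> U) E (rho_map \<SS> V U p)"
      \<comment> \<open>orthogonality\<close>
    and orth_sym_irrefl:
      "symp_on (domains \<SS>) (orth \<SS>)" "irreflp_on (domains \<SS>) (orth \<SS>)"
    and orth_nest:
      "\<And>U V W. \<lbrakk>U \<in> domains \<SS>; V \<in> domains \<SS>; W \<in> domains \<SS>; nest \<SS> V W; orth \<SS> W U\<rbrakk> \<Longrightarrow>
         orth \<SS> V U"
    and orth_not_comparable:
      "\<And>V W. \<lbrakk>V \<in> domains \<SS>; W \<in> domains \<SS>; orth \<SS> V W\<rbrakk> \<Longrightarrow> \<not> nest \<SS> V W \<and> \<not> nest \<SS> W V"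
    and orth_container:
      "\<And>T U. \<lbrakk>T \<in> domains \<SS>; U \<in> domains \<SS>; nest \<SS> U T;
              \<exists>V\<in>domains \<SS>. nest \<SS> V T \<and> orth \<SS> V U\<rbrakk> \<Longrightarrow>
         \<exists>W\<in>domains \<SS>. pnest \<SS> W T \<and>
           (\<forall>V\<in>domains \<SS>. nest \<SS> V T \<and> orth \<SS> V U \<longrightarrow> nest \<SS> V W)"
      \<comment> \<open>transversality and consistency\<close>
    and transverse_rho:
      "\<And>U V. \<lbrakk>U \<in> domains \<SS>; V \<in> domains \<SS>; transverse \<SS> U V\<rbrakk> \<Longrightarrow>
         coarse_point (cspace \<SS> V) E (rho \<SS> U V)"
    and transverse_consistency:
      "\<And>U V x. \<lbrakk>U \<in> domains \<SS>; V \<in> domains \<SS>; transverse \<SS> U V; x \<in> carrier G\<rbrakk> \<Longrightarrow>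
         min (dist_to \<SS> U x (rho \<SS> V U)) (dist_to \<SS> V x (rho \<SS> U V)) \<le> E"
    and nest_consistency:
      "\<And>U V x. \<lbrakk>U \<in> domains \<SS>; V \<in> domains \<SS>; pnest \<SS> U V; x \<in> carrier G\<rbrakk> \<Longrightarrow>
         dist_to \<SS> V x (rho \<SS> U V) \<le> E \<or>
         diam_le (cspace \<SS> U) (proj \<SS> U x \<union> (\<Union>p\<in>proj \<SS> V x. rho_map \<SS> V U p)) E"
    and rho_consistency:
      "\<And>U V W. \<lbrakk>U \<in> domains \<SS>; V \<in> domains \<SS>; W \<in> domains \<SS>; nest \<SS> U V;
                pnest \<SS> V W \<or> (transverse \<SS> V W \<and> \<not> orth \<SS> W U)\<rbrakk> \<Longrightarrow>
         set_dist (cspace \<SS> W) (rho \<SS> U W) (rho \<SS> V W) \<le> E"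
    and finite_complexity:
      "\<exists>n::nat. \<forall>\<C>. \<C> \<subseteq> domains \<SS> \<and> (\<forall>U\<in>\<C>. \<forall>V\<in>\<C>. nest \<SS> U V \<or> nest \<SS> V U) \<longrightarrow>
         finite \<C> \<and> card \<C> \<le> n"
    and large_links:
      "\<exists>l::real. l \<ge> 1 \<and> (\<forall>W\<in>domains \<SS>. \<forall>x\<in>carrier G. \<forall>x'\<in>carrier G.
         (let N = l * dist_at \<SS> W x x' + l in
          \<exists>\<T>. \<T> \<subseteq> {T \<in> domains \<SS>. pnest \<SS> T W} \<and> finite \<T> \<and> int (card \<T>) \<le> \<lfloor>N\<rfloor> \<and>
            (\<forall>T\<in>domains \<SS>. pnest \<SS> T W \<longrightarrow> (\<exists>T'\<in>\<T>. nest \<SS> T T') \<or> dist_at \<SS> T x x' < E) \<and>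
            (\<forall>T'\<in>\<T>. dist_to \<SS> W x (rho \<SS> T' W) \<le> N)))"
    and bounded_geodesic_image:
      "\<And>V W \<gamma>. \<lbrakk>V \<in> domains \<SS>; W \<in> domains \<SS>; pnest \<SS> V W; geodesic_segment (cspace \<SS> W) \<gamma>\<rbrakk> \<Longrightarrow>
         diam_le (cspace \<SS> V) (\<Union>p\<in>\<gamma>. rho_map \<SS> W V p) E \<or>
         (\<exists>p\<in>\<gamma>. set_dist (cspace \<SS> W) {p} (rho \<SS> V W) \<le> E)"
    and partial_realisation:
      "\<And>\<V> p. \<lbrakk>\<V> \<subseteq> domains \<SS>; pairwise (orth \<SS>) \<V>;
               \<And>V. V \<in> \<V> \<Longrightarrow> p V \<in> (\<Union>x\<in>carrier G. proj \<SS> V x)\<rbrakk> \<Longrightarrow>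
         \<exists>x\<in>carrier G. \<forall>V\<in>\<V>. dist_to \<SS> V x {p V} \<le> E \<and>
           (\<forall>W\<in>domains \<SS>. pnest \<SS> V W \<or> transverse \<SS> W V \<longrightarrow> dist_to \<SS> W x (rho \<SS> V W) \<le> E)"
    and uniqueness:
      "\<exists>E' :: real \<Rightarrow> real. E' 0 = E \<and> (\<forall>\<kappa>\<ge>0. E' \<kappa> \<ge> 0 \<and>
         (\<forall>x\<in>carrier G. \<forall>y\<in>carrier G.
            (\<forall>V\<in>domains \<SS>. dist_at \<SS> V x y < \<kappa>) \<longrightarrow> word_dist G X x y < E' \<kappa>))"
      \<comment> \<open>equivariance\<close>
    and action: "group_action G (domains \<SS>) (dom_act \<SS>)"
    and cofinite_action: "finite (orbits G (domains \<SS>) (dom_act \<SS>))"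
    and action_preserves:
      "\<And>g U V. \<lbrakk>g \<in> carrier G; U \<in> domains \<SS>; V \<in> domains \<SS>\<rbrakk> \<Longrightarrow>
         (nest \<SS> (dom_act \<SS> g U) (dom_act \<SS> g V) \<longleftrightarrow> nest \<SS> U V) \<and>
         (orth \<SS> (dom_act \<SS> g U) (dom_act \<SS> g V) \<longleftrightarrow> orth \<SS> U V) \<and>
         (transverse \<SS> (dom_act \<SS> g U) (dom_act \<SS> g V) \<longleftrightarrow> transverse \<SS> U V)"
    and isom_surj:
      "\<And>g U. \<lbrakk>g \<in> carrier G; U \<in> domains \<SS>\<rbrakk> \<Longrightarrow>
         isom \<SS> g U ` mspace (cspace \<SS> U) = mspace (cspace \<SS> (dom_act \<SS> g U))"
    and isom_dist:
      "\<And>g U p q. \<lbrakk>g \<in> carrier G; U \<in> domains \<SS>; p \<in> mspace (cspace \<SS> U); q \<in> mspace (cspace \<SS> U)\<rbrakk> \<Longrightarrow>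
         mdist (cspace \<SS> (dom_act \<SS> g U)) (isom \<SS> g U p) (isom \<SS> g U q) = mdist (cspace \<SS> U) p q"
    and isom_mult:
      "\<And>g h U p. \<lbrakk>g \<in> carrier G; h \<in> carrier G; U \<in> domains \<SS>; p \<in> mspace (cspace \<SS> U)\<rbrakk> \<Longrightarrow>
         isom \<SS> (g \<otimes> h) U p = isom \<SS> g (dom_act \<SS> h U) (isom \<SS> h U p)"
    and proj_equivariant:
      "\<And>g U x. \<lbrakk>g \<in> carrier G; U \<in> domains \<SS>; x \<in> carrier G\<rbrakk> \<Longrightarrow>
         isom \<SS> g U ` proj \<SS> U x = proj \<SS> (dom_act \<SS> g U) (g \<otimes> x)"
    and rho_equivariant:
      "\<And>g U V. \<lbrakk>g \<in> carrier G; U \<in> domains \<SS>; V \<in> domains \<SS>; pnest \<SS> U V \<or> transverse \<SS> U V\<rbrakk> \<Longrightarrow>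
         isom \<SS> g V ` rho \<SS> U V = rho \<SS> (dom_act \<SS> g U) (dom_act \<SS> g V)"

definition product_region ::
    "('g, 'x) monoid_scheme \<Rightarrow> ('g, 'd, 'c) hh_structure \<Rightarrow> real \<Rightarrow> 'd \<Rightarrow> 'g set" where
  "product_region G \<SS> E U = {x \<in> carrier G. \<forall>V\<in>domains \<SS>.
     transverse \<SS> V U \<or> pnest \<SS> U V \<longrightarrow> dist_to \<SS> V x (rho \<SS> U V) \<le> E}"

text \<open>Left multiplication by the subgroup \<open>H\<close> on \<open>P\<close>; the orbit of \<open>x\<close> is the coset \<open>H #>\<^bsub>G\<^esub> x\<close>.\<close>

definition acts_cocompactly :: "('g, 'x) monoid_scheme \<Rightarrow> 'g set \<Rightarrow> 'g set \<Rightarrow> bool" where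
  "acts_cocompactly G H P \<longleftrightarrow> (\<exists>F. finite F \<and> F \<subseteq> P \<and> P \<subseteq> (\<Union>x\<in>F. H #>\<^bsub>G\<^esub> x))"

definition BBF_colouring ::
    "'g set \<Rightarrow> ('g, 'd, 'c) hh_structure \<Rightarrow> nat \<Rightarrow> (nat \<Rightarrow> 'd set) \<Rightarrow> bool" where
  "BBF_colouring K \<SS> n D \<longleftrightarrow>
     (\<Union>i\<in>{1..n}. D i) = domains \<SS> \<and> disjoint_family_on D {1..n} \<and>
     (\<forall>i\<in>{1..n}. \<forall>g\<in>K. \<forall>U\<in>D i. dom_act \<SS> g U \<in> D i) \<and>
     (\<forall>i\<in>{1..n}. \<forall>U\<in>D i. \<forall>V\<in>D i. U \<noteq> V \<longrightarrow> transverse \<SS> U V)"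

definition admits_BBF_colouring :: "'g set \<Rightarrow> ('g, 'd, 'c) hh_structure \<Rightarrow> bool" where
  "admits_BBF_colouring K \<SS> \<longleftrightarrow> (\<exists>n D. BBF_colouring K \<SS> n D)"

end

theory Submission
  imports Defs
begin

text \<open>
  Let \<open>H = Stab(U)\<close>.  If \<open>gU \<bottom> U\<close>, then partial realisation for \<open>{U, gU}\<close> gives a point of
  \<open>P\<^sub>U \<inter> gP\<^sub>U\<close>, so by cocompactness \<open>g\<close> lies in one of finitely many double cosets \<open>HcH\<close> with \<open>c \<notin> H\<close>.
  Separability of \<open>H\<close> gives finite-index subgroups containing \<open>H\<close> whose intersection avoids all these
  \<open>c\<close>, hence also the double cosets.  A finite-index normal subgroup \<open>N\<close> contained in these subgroups,
  for \<open>U\<close> ranging over representatives of the finitely many orbits, moves no domain to an orthogonal one.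
  Finite complexity prevents \<open>gU\<close> from being properly nested in \<open>U\<close>, so distinct domains in the same
  \<open>N\<close>-orbit are transverse, and the \<open>N\<close>-orbits are the colours.
\<close>

section \<open>Finite-index subgroups\<close>

text \<open>The witness is the kernel of the action of \<open>G\<close> by right multiplication on the right cosets of all
  members of \<open>\<F>\<close>.\<close>

lemma (in group) finite_index_normal_subgroup:
  assumes fin: "finite \<F>" and \<F>: "\<And>K. K \<in> \<F> \<Longrightarrow> finite_index_subgroup K G"
  shows "\<exists>N. N \<lhd> G \<and> finite_index_subgroup N G \<and> N \<subseteq> \<Inter>\<F>"
proof -
  define S where "S = (\<Union>K\<in>\<F>. rcosets K)"
  define N where "N = {x \<in> carrier G. \<forall>C\<in>S. C #> x = C}"
  have finS: "finite S"
    using fin \<F> by (auto simp: S_def finite_index_subgroup_def)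
  have sub: "C \<subseteq> carrier G" if "C \<in> S" for C
    using that \<F> by (auto simp: S_def finite_index_subgroup_def dest: rcosets_subset_PowG)
  \<comment> \<open>Right multiplication maps \<open>S\<close> into itself, so
    \<open>carrier G\<close> acts on this finite set.\<close>
  have closed: "C #> x \<in> S" if C: "C \<in> S" and x: "x \<in> carrier G" for C x
  proof -
    obtain K a where K: "K \<in> \<F>" "a \<in> carrier G" "C = K #> a"
      using C by (auto simp: S_def RCOSETS_def)
    moreover have Ksub: "K \<subseteq> carrier G"
      using \<F>[OF K(1)] by (auto simp: finite_index_subgroup_def dest: subgroup.subset)
    ultimately have "C #> x = K #> (a \<otimes> x)"
      using x by (simp add: coset_mult_assoc)
    then show ?thesis
      using K x Ksub by (auto simp: S_def intro!: rcosetsI)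
  qed
  \<comment> \<open>Since \<open>N\<close> is the kernel of the action, elements acting alike on
    \<open>S\<close> differ by an element of \<open>N\<close>. This serves for inverses, for
    normality and for finiteness of the index.\<close>
  have inv_fix: "x \<otimes> inv y \<in> N"
    if x: "x \<in> carrier G" and y: "y \<in> carrier G" and eq: "\<And>C. C \<in> S \<Longrightarrow> C #> x = C #> y" for x y
  proof -
    have "C #> (x \<otimes> inv y) = C" if "C \<in> S" for C
    proof -
      have "C #> (x \<otimes> inv y) = C #> y #> inv y"
        using sub[OF that] x y eq[OF that] by (simp flip: coset_mult_assoc)
      also have "\<dots> = C"
        using sub[OF that] y by (simp add: coset_mult_assoc)
      finally show ?thesis .
    qed
    then show ?thesis
      using x y by (simp add: N_def)
  qed
  have subN: "subgroup N G"
  proof (rule subgroupI)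
    show "N \<subseteq> carrier G"
      by (auto simp: N_def)
    show "N \<noteq> {}"
      using sub by (auto simp: N_def intro!: exI[of _ \<one>])
    show "inv a \<in> N" if "a \<in> N" for a
      using inv_fix[of \<one> a] that sub by (auto simp: N_def)
    show "a \<otimes> b \<in> N" if "a \<in> N" "b \<in> N" for a b
      using that sub by (auto simp: N_def simp flip: coset_mult_assoc)
  qed
  have "N \<lhd> G"
    unfolding normal_inv_iff
  proof (intro conjI subN ballI)
    fix g h assume g: "g \<in> carrier G" and h: "h \<in> N"
    have hG: "h \<in> carrier G"
      using h by (simp add: N_def)
    \<comment> \<open>The elements \<open>g \<otimes> h\<close> and \<open>g\<close> act alike,
      because \<open>h\<close> fixes the coset \<open>C #> g\<close>, which is again in
      \<open>S\<close>.\<close>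
    show "g \<otimes> h \<otimes> inv g \<in> N"
    proof (rule inv_fix)
      fix C assume C: "C \<in> S"
      have "C #> (g \<otimes> h) = C #> g #> h"
        using C g hG sub by (simp add: coset_mult_assoc)
      then show "C #> (g \<otimes> h) = C #> g"
        using h closed[OF C g] by (simp add: N_def)
    qed (use g hG in auto)
  qed
  moreover have "finite (rcosets N)"
  proof -
    \<comment> \<open>\<open>restrict\<close> turns the action of \<open>x\<close> into an element
      of the finite set \<open>S \<rightarrow>\<^sub>E S\<close>. By \<open>inv_fix\<close> this
      element determines the coset \<open>N #> x\<close>, so there are only finitely many
      cosets.\<close>
    define f where "f x = restrict (\<lambda>C. C #> x) S" for x
    have "f ` carrier G \<subseteq> S \<rightarrow>\<^sub>E S"
      using closed by (auto simp: f_def)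
    then have finf: "finite (f ` carrier G)"
      using finS by (meson finite_PiE finite_subset)
    have same: "N #> x = N #> y" if x: "x \<in> carrier G" and y: "y \<in> carrier G" and eq: "f x = f y" for x y
    proof -
      have "C #> x = C #> y" if "C \<in> S" for C
        using fun_cong[OF eq, of C] that by (simp add: f_def)
      then have "x \<otimes> inv y \<in> N"
        using inv_fix x y by blast
      then have "x \<in> N #> y"
        using subgroup.rcos_module_rev[OF subN is_group] x y by blast
      then show ?thesis
        using repr_independence subN y by blast
    qed
    have "rcosets N = (\<lambda>x. N #> x) ` carrier G"
      by (auto simp: RCOSETS_def)
    also have "\<dots> \<subseteq> (\<lambda>v. N #> inv_into (carrier G) f v) ` f ` carrier G"
    proof
      fix C assume "C \<in> (\<lambda>x. N #> x) ` carrier G"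
      then obtain x where x: "x \<in> carrier G" "C = N #> x"
        by auto
      have "inv_into (carrier G) f (f x) \<in> carrier G" "f (inv_into (carrier G) f (f x)) = f x"
        using x by (auto intro: inv_into_into f_inv_into_f)
      then have "C = N #> inv_into (carrier G) f (f x)"
        using same x by metis
      then show "C \<in> (\<lambda>v. N #> inv_into (carrier G) f v) ` f ` carrier G"
        using x by blast
    qed
    finally show ?thesis
      using finf by (meson finite_imageI finite_subset)
  qed
  moreover have "N \<subseteq> \<Inter>\<F>"
  proof clarify
    fix x K assume x: "x \<in> N" and K: "K \<in> \<F>"
    have K': "subgroup K G"
      using \<F>[OF K] by (simp add: finite_index_subgroup_def)
    \<comment> \<open>\<open>K\<close> is itself one of the cosets acted on, and an element fixing
      it lies in \<open>K\<close>.\<close>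
    then have "K \<in> S"
      using K subgroup.subgroup_in_rcosets[OF _ is_group] by (auto simp: S_def)
    then show "x \<in> K"
      using x K' coset_join1 by (auto simp: N_def)
  qed
  ultimately show ?thesis
    using subN by (auto simp: finite_index_subgroup_def)
qed

text \<open>Each element of \<open>C\<close> is missed by some member of a family of finite-index
  subgroups with intersection \<open>H\<close>; one such member for each element suffices.\<close>

lemma separable_subgroup_avoid_finite:
  assumes "separable_subgroup H G" "finite C" "C \<inter> H = {}"
  shows "\<exists>\<F>. finite \<F> \<and> (\<forall>K\<in>\<F>. finite_index_subgroup K G \<and> H \<subseteq> K) \<and> C \<inter> \<Inter>\<F> = {}"
proof -
  obtain \<F> where \<F>: "\<And>K. K \<in> \<F> \<Longrightarrow> finite_index_subgroup K G" "H = \<Inter>\<F>"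
    using assms(1) by (auto simp: separable_subgroup_def)
  have "\<forall>c\<in>C. \<exists>K\<in>\<F>. c \<notin> K"
    using assms(3) \<F>(2) by blast
  then obtain k where k: "\<And>c. c \<in> C \<Longrightarrow> k c \<in> \<F> \<and> c \<notin> k c"
    by metis
  show ?thesis
    using assms(2) k \<F> by (intro exI[of _ "k ` C"]) blast
qed

section \<open>The action on domains\<close>

context hierarchically_hyperbolic_group
begin

lemma dom_act_closed:
  "\<lbrakk>g \<in> carrier G; U \<in> domains \<SS>\<rbrakk> \<Longrightarrow> dom_act \<SS> g U \<in> domains \<SS>"
  using group_action.element_image[OF action] by blast

lemma dom_act_mult:
  "\<lbrakk>g \<in> carrier G; h \<in> carrier G; U \<in> domains \<SS>\<rbrakk> \<Longrightarrow>
     dom_act \<SS> (g \<otimes> h) U = dom_act \<SS> g (dom_act \<SS> h U)"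
  using group_action.composition_rule[OF action] by blast

lemma dom_act_one: "U \<in> domains \<SS> \<Longrightarrow> dom_act \<SS> \<one> U = U"
  using group_action.id_eq_one[OF action] by (metis restrict_apply')

lemma dom_act_inv:
  "\<lbrakk>g \<in> carrier G; U \<in> domains \<SS>\<rbrakk> \<Longrightarrow> dom_act \<SS> (inv g) (dom_act \<SS> g U) = U"
  using group_action.orbit_sym_aux[OF action] by blast

lemma transverse_sym:
  "\<lbrakk>U \<in> domains \<SS>; V \<in> domains \<SS>; transverse \<SS> U V\<rbrakk> \<Longrightarrow> transverse \<SS> V U"
  using orth_sym_irrefl(1) by (auto simp: transverse_def symp_on_def)

lemma pnest_dom_act_iff:
  assumes "g \<in> carrier G" "U \<in> domains \<SS>" "V \<in> domains \<SS>"
  shows "pnest \<SS> (dom_act \<SS> g U) (dom_act \<SS> g V) \<longleftrightarrow> pnest \<SS> U V"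
  using assms action_preserves dom_act_inv unfolding pnest_def by metis

text \<open>Otherwise the iterates \<open>g\<^sup>nU\<close> would form an infinite chain.\<close>

lemma nest_dom_act_imp_eq:
  assumes g: "g \<in> carrier G" and U: "U \<in> domains \<SS>" and nst: "nest \<SS> (dom_act \<SS> g U) U"
  shows "dom_act \<SS> g U = U"
proof -
  define u where "u n = dom_act \<SS> (g [^] (n::nat)) U" for n
  have u_dom: "u n \<in> domains \<SS>" for n
    using g U by (simp add: u_def dom_act_closed)
  have u_add: "u (m + n) = dom_act \<SS> (g [^] m) (u n)" for m n
    using g U by (simp add: u_def dom_act_mult flip: nat_pow_mult)
  have u0: "u 0 = U" and u1: "u 1 = dom_act \<SS> g U"
    using g U by (simp_all add: u_def dom_act_one)
  have step: "nest \<SS> (u (Suc n)) (u n)" for n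
    using action_preserves[of "g [^] n" "u 1" U] g U u_dom nst u_add[of n 1] u_add[of n 0] u0 u1
    by auto
  have anti: "nest \<SS> (u n) (u m)" if "m \<le> n" for m n
    using that
  proof (induction n rule: dec_induct)
    case base
    then show ?case
      using nest_partial_order(1) u_dom by (auto simp: reflp_on_def)
  next
    case (step n)
    then show ?case
      using nest_partial_order(3) \<open>\<And>n. nest \<SS> (u (Suc n)) (u n)\<close> u_dom
      by (meson transp_onD)
  qed
  have "\<forall>A\<in>range u. \<forall>B\<in>range u. nest \<SS> A B \<or> nest \<SS> B A"
    using anti nat_le_linear by blast
  moreover have "range u \<subseteq> domains \<SS>"
    using u_dom by auto
  ultimately have "finite (range u)"
    using finite_complexity by meson
  then have "\<not> inj u"
    using finite_imageD infinite_UNIV_nat by blast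
  then obtain m n where mn: "m < n" "u m = u n"
    by (metis injI linorder_neqE_nat)
  \<comment> \<open>Cancelling \<open>g [^] m\<close> in \<open>u m = u n\<close> shows that the
    descending chain is back at \<open>U\<close> after \<open>k \<ge> 1\<close> steps. Hence
    \<open>U\<close> is also nested in \<open>u 1\<close>, and antisymmetry applies.\<close>
  define k where "k = n - m"
  have k: "k \<ge> 1" and "u (m + k) = u m"
    using mn by (auto simp: k_def)
  then have "dom_act \<SS> (g [^] m) (u k) = dom_act \<SS> (g [^] m) U"
    using u_add[of m k] u_add[of m 0] u0 by simp
  then have "u k = U"
    using dom_act_inv[of "g [^] m"] g U u_dom[of k] by (metis nat_pow_closed)
  then have "nest \<SS> U (u 1)"
    using anti[OF k] by simp
  then show ?thesis
    using nst nest_partial_order(2) u1 U u_dom[of 1] by (auto simp: antisymp_on_def)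
qed

text \<open>Of the two possible nestings, one is excluded by \<open>nest_dom_act_imp_eq\<close> for
  \<open>g\<close> and the other by the same lemma for \<open>inv g\<close>.\<close>

lemma dom_act_transverse:
  assumes g: "g \<in> carrier G" and U: "U \<in> domains \<SS>"
    and ne: "dom_act \<SS> g U \<noteq> U" and north: "\<not> orth \<SS> (dom_act \<SS> g U) U"
  shows "transverse \<SS> (dom_act \<SS> g U) U"
proof -
  have "\<not> nest \<SS> U (dom_act \<SS> g U)"
  proof
    assume "nest \<SS> U (dom_act \<SS> g U)"
    then have "nest \<SS> (dom_act \<SS> (inv g) U) U"
      using action_preserves[of "inv g" U "dom_act \<SS> g U"] g U
      by (simp add: dom_act_closed dom_act_inv)
    then have "dom_act \<SS> (inv g) U = U"
      using nest_dom_act_imp_eq g U by blast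
    then show False
      using ne dom_act_inv[of "inv g" U] g U by simp
  qed
  then show ?thesis
    using assms nest_dom_act_imp_eq by (auto simp: transverse_def)
qed

section \<open>Orthogonal translates\<close>

text \<open>The isometry of \<open>g\<close> carries \<open>proj \<SS> V x\<close> to the projection
  of \<open>g \<otimes> x\<close>, so both infima run over the same set of real numbers.\<close>

lemma dist_to_dom_act:
  assumes g: "g \<in> carrier G" and V: "V \<in> domains \<SS>" and x: "x \<in> carrier G"
    and B: "B \<subseteq> mspace (cspace \<SS> V)"
  shows "dist_to \<SS> (dom_act \<SS> g V) (g \<otimes> x) (isom \<SS> g V ` B) = dist_to \<SS> V x B"
proof -
  have P: "proj \<SS> V x \<subseteq> mspace (cspace \<SS> V)"
    using proj_coarse_map[OF V x] by (simp add: coarse_point_def)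
  have "(\<lambda>(a, b). mdist (cspace \<SS> (dom_act \<SS> g V)) a b) ` ((isom \<SS> g V ` proj \<SS> V x) \<times> (isom \<SS> g V ` B))
      = (\<lambda>(a, b). mdist (cspace \<SS> (dom_act \<SS> g V)) (isom \<SS> g V a) (isom \<SS> g V b)) ` (proj \<SS> V x \<times> B)"
    by (simp add: image_image case_prod_unfold flip: image_paired_Times)
  also have "\<dots> = (\<lambda>(a, b). mdist (cspace \<SS> V) a b) ` (proj \<SS> V x \<times> B)"
    using isom_dist[OF g V] P B by (intro image_cong) auto
  finally show ?thesis
    using proj_equivariant[OF g V x, symmetric]
    by (simp add: dist_to_def set_dist_def image_def Bex_def conj_commute conj_left_commute)
qed

text \<open>By equivariance of the sets \<open>rho\<close>, the condition at \<open>V\<close> for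
  the translate is the condition at \<open>dom_act \<SS> (inv g) V\<close> for
  \<open>x\<close>.\<close>

lemma product_region_dom_act:
  assumes g: "g \<in> carrier G" and U: "U \<in> domains \<SS>"
    and x: "x \<in> product_region G \<SS> E U"
  shows "g \<otimes> x \<in> product_region G \<SS> E (dom_act \<SS> g U)"
proof -
  have xG: "x \<in> carrier G"
    using x by (simp add: product_region_def)
  have "dist_to \<SS> V (g \<otimes> x) (rho \<SS> (dom_act \<SS> g U) V) \<le> E"
    if V: "V \<in> domains \<SS>"
      and tr: "transverse \<SS> V (dom_act \<SS> g U) \<or> pnest \<SS> (dom_act \<SS> g U) V" for V
  proof -
    define V' where "V' = dom_act \<SS> (inv g) V"
    have V': "V' \<in> domains \<SS>" and gV': "dom_act \<SS> g V' = V"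
      using g V dom_act_closed dom_act_inv[of "inv g" V] by (auto simp: V'_def)
    have tr': "transverse \<SS> V' U \<or> pnest \<SS> U V'"
      using tr action_preserves[OF g V' U] pnest_dom_act_iff[OF g U V'] gV' by auto
    \<comment> \<open>\<open>product_region\<close> has \<open>U\<close> as the second argument of
      \<open>transverse\<close>, whereas \<open>rho_equivariant\<close> has it as the first.\<close>
    then have tr'': "pnest \<SS> U V' \<or> transverse \<SS> U V'"
      using transverse_sym U V' by blast
    have "rho \<SS> U V' \<subseteq> mspace (cspace \<SS> V')"
      using nest_rho[OF U V'] transverse_rho[OF U V'] tr'' by (auto simp: coarse_point_def)
    then have "dist_to \<SS> V (g \<otimes> x) (rho \<SS> (dom_act \<SS> g U) V) = dist_to \<SS> V' x (rho \<SS> U V')"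
      using dist_to_dom_act[OF g V' xG] rho_equivariant[OF g U V' tr''] gV' by metis
    then show ?thesis
      using x V' tr' by (auto simp: product_region_def)
  qed
  then show ?thesis
    using g xG by (simp add: product_region_def)
qed

text \<open>The clause of \<open>partial_realisation\<close> about the sets \<open>rho\<close> is
  the defining condition of a product region, obtained for both domains at the same point.\<close>

lemma orth_product_regions_meet:
  assumes U: "U \<in> domains \<SS>" and V: "V \<in> domains \<SS>" and UV: "orth \<SS> U V"
  shows "product_region G \<SS> E U \<inter> product_region G \<SS> E V \<noteq> {}"
proof -
  \<comment> \<open>Any points in the images of the projections will do; these come from the
    identity element.\<close>
  define p where "p W = (SOME q. q \<in> proj \<SS> W \<one>)" for W
  have "p W \<in> (\<Union>x\<in>carrier G. proj \<SS> W x)" if "W \<in> {U, V}" for W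
  proof -
    have "proj \<SS> W \<one> \<noteq> {}"
      using proj_coarse_map[of W \<one>] U V that by (auto simp: coarse_point_def)
    then have "p W \<in> proj \<SS> W \<one>"
      by (simp add: p_def some_in_eq)
    then show ?thesis
      by blast
  qed
  moreover have "pairwise (orth \<SS>) {U, V}"
    using UV U V orth_sym_irrefl(1) by (auto simp: pairwise_def symp_on_def)
  ultimately obtain x where "x \<in> carrier G"
    "\<forall>W\<in>{U, V}. \<forall>T\<in>domains \<SS>. pnest \<SS> W T \<or> transverse \<SS> T W \<longrightarrow> dist_to \<SS> T x (rho \<SS> W T) \<le> E"
    using partial_realisation[of "{U, V}" p] U V by blast
  then have "x \<in> product_region G \<SS> E U \<inter> product_region G \<SS> E V"
    by (auto simp: product_region_def)
  then show ?thesis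
    by blast
qed

text \<open>Intersecting with \<open>carrier G\<close> covers an empty \<open>\<F>\<close>, for
  which \<open>\<Inter>\<F>\<close> is the whole type.\<close>

lemma finite_index_no_orthogonal_translate:
  assumes U: "U \<in> domains \<SS>"
    and sep: "separable_subgroup (stabilizer G (dom_act \<SS>) U) G"
    and coc: "acts_cocompactly G (stabilizer G (dom_act \<SS>) U) (product_region G \<SS> E U)"
  shows "\<exists>\<F>. finite \<F> \<and> (\<forall>K\<in>\<F>. finite_index_subgroup K G) \<and>
    (\<forall>g\<in>carrier G \<inter> \<Inter>\<F>. \<not> orth \<SS> (dom_act \<SS> g U) U)"
proof -
  define H where "H = stabilizer G (dom_act \<SS>) U"
  have H: "subgroup H G"
    using group_action.stabilizer_subgroup[OF action U] by (simp add: H_def)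
  obtain F where F: "finite F" "F \<subseteq> product_region G \<SS> E U"
    "product_region G \<SS> E U \<subseteq> (\<Union>x\<in>F. H #> x)"
    using coc by (auto simp: acts_cocompactly_def H_def)
  have FG: "F \<subseteq> carrier G"
    using F(2) by (auto simp: product_region_def)
  \<comment> \<open>The finitely many candidates for double coset representatives, without those in
    \<open>H\<close>.\<close>
  define C where "C = (\<lambda>(a, b). a \<otimes> inv b) ` (F \<times> F) - H"
  have "finite C" "C \<inter> H = {}"
    using F(1) by (auto simp: C_def)
  then obtain \<F> where \<F>: "finite \<F>" "\<And>K. K \<in> \<F> \<Longrightarrow> finite_index_subgroup K G \<and> H \<subseteq> K" "C \<inter> \<Inter>\<F> = {}"
    using separable_subgroup_avoid_finite sep unfolding H_def by meson
  have "\<not> orth \<SS> (dom_act \<SS> g U) U" if g: "g \<in> carrier G" and gF: "g \<in> \<Inter>\<F>" for g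
  proof
    assume orth: "orth \<SS> (dom_act \<SS> g U) U"
    have gU: "dom_act \<SS> g U \<in> domains \<SS>"
      using dom_act_closed g U .
    obtain x where x: "x \<in> product_region G \<SS> E U" "x \<in> product_region G \<SS> E (dom_act \<SS> g U)"
      using orth_product_regions_meet[OF gU U orth] by blast
    have xG: "x \<in> carrier G"
      using x by (simp add: product_region_def)
    \<comment> \<open>Both \<open>x\<close> and \<open>inv g \<otimes> x\<close> lie in the product
      region of \<open>U\<close>, hence in \<open>H\<close>-orbits of points of \<open>F\<close>.
      Comparing the two expressions puts \<open>g\<close> in the double coset of
      \<open>a \<otimes> inv b\<close>.\<close>
    have "inv g \<otimes> x \<in> product_region G \<SS> E U"
      using product_region_dom_act[OF _ gU x(2), of "inv g"] g U by (simp add: dom_act_inv)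
    then obtain h b where h: "h \<in> H" "b \<in> F" "inv g \<otimes> x = h \<otimes> b"
      using F(3) by (auto simp: r_coset_def)
    obtain h' a where h': "h' \<in> H" "a \<in> F" "x = h' \<otimes> a"
      using x(1) F(3) by (auto simp: r_coset_def)
    have carr: "h \<in> carrier G" "h' \<in> carrier G" "a \<in> carrier G" "b \<in> carrier G"
      using h h' FG subgroup.mem_carrier[OF H] by auto
    have "h' \<otimes> a = g \<otimes> (h \<otimes> b)"
      using h h' g xG by (metis inv_closed inv_solve_left m_closed carr(1,4) inv_inv)
    then have "a = inv h' \<otimes> (g \<otimes> (h \<otimes> b))"
      using carr g by (simp add: inv_solve_left)
    then have c: "a \<otimes> inv b = inv h' \<otimes> g \<otimes> h"
      using carr g by (simp add: m_assoc)
    then have g_eq: "g = h' \<otimes> (a \<otimes> inv b) \<otimes> inv h"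
      using carr g by (simp add: m_assoc) (simp flip: m_assoc)
    \<comment> \<open>An element of \<open>H\<close> fixes \<open>U\<close>, which is not orthogonal
      to itself.\<close>
    have "g \<notin> H"
      using orth orth_sym_irrefl(2) U by (auto simp: H_def stabilizer_def irreflp_on_def)
    then have "a \<otimes> inv b \<notin> H"
      using g_eq h h' H by (metis subgroup.m_closed subgroup.m_inv_closed)
    then have "a \<otimes> inv b \<in> C"
      using h h' by (auto simp: C_def)
    \<comment> \<open>Each \<open>K\<close> contains \<open>g\<close> and all of \<open>H\<close>,
      hence the whole double coset of \<open>g\<close>, contrary to the choice of
      \<open>\<F>\<close>.\<close>
    moreover have "a \<otimes> inv b \<in> K" if "K \<in> \<F>" for K
    proof -
      have "subgroup K G" "h \<in> K" "h' \<in> K" "g \<in> K"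
        using \<F>(2)[OF that] h h' gF that by (auto simp: finite_index_subgroup_def)
      then show ?thesis
        unfolding c by (meson subgroup.m_closed subgroup.m_inv_closed)
    qed
    ultimately show False
      using \<F>(3) by blast
  qed
  then show ?thesis
    using \<F> by blast
qed

section \<open>The colouring\<close>

lemma orbit_representatives:
  "\<exists>R. finite R \<and> R \<subseteq> domains \<SS> \<and> (\<forall>W\<in>domains \<SS>. \<exists>U\<in>R. \<exists>g\<in>carrier G. W = dom_act \<SS> g U)"
proof -
  have "\<forall>Q\<in>orbits G (domains \<SS>) (dom_act \<SS>). \<exists>U\<in>domains \<SS>. Q = orbit G (dom_act \<SS>) U"
    by (auto simp: orbits_def)
  then obtain r where r: "\<And>Q. Q \<in> orbits G (domains \<SS>) (dom_act \<SS>) \<Longrightarrow>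
      r Q \<in> domains \<SS> \<and> Q = orbit G (dom_act \<SS>) (r Q)"
    by metis
  have "\<exists>U\<in>r ` orbits G (domains \<SS>) (dom_act \<SS>). \<exists>g\<in>carrier G. W = dom_act \<SS> g U"
    if W: "W \<in> domains \<SS>" for W
  proof -
    define Q where "Q = orbit G (dom_act \<SS>) W"
    have Q: "Q \<in> orbits G (domains \<SS>) (dom_act \<SS>)"
      using W by (auto simp: Q_def orbits_def)
    have "W \<in> Q"
      using group_action.orbit_refl[OF action W] by (simp add: Q_def)
    then have "W \<in> orbit G (dom_act \<SS>) (r Q)"
      using r[OF Q] by simp
    then show ?thesis
      using Q by (auto simp: orbit_def)
  qed
  then show ?thesis
    using r cofinite_action by (intro exI[of _ "r ` orbits G (domains \<SS>) (dom_act \<SS>)"]) auto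
qed

lemma BBF_colouring_by_orbits:
  assumes N: "finite_index_subgroup N G"
    and north: "\<And>g U. \<lbrakk>g \<in> N; U \<in> domains \<SS>\<rbrakk> \<Longrightarrow> \<not> orth \<SS> (dom_act \<SS> g U) U"
  shows "admits_BBF_colouring N \<SS>"
proof -
  have subN: "subgroup N G" and fin: "finite (rcosets N)"
    using N by (auto simp: finite_index_subgroup_def)
  note N_carrier = subgroup.mem_carrier[OF subN]
  define orb where "orb W = (\<lambda>k. dom_act \<SS> k W) ` N" for W
  have orb_self: "W \<in> orb W" if "W \<in> domains \<SS>" for W
    using dom_act_one[OF that] subgroup.one_closed[OF subN] by (force simp: orb_def)
  have orb_dom: "orb W \<subseteq> domains \<SS>" if "W \<in> domains \<SS>" for W
    using that dom_act_closed N_carrier by (auto simp: orb_def)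
  \<comment> \<open>The \<open>N\<close>-orbit of a translate of \<open>W\<close> depends only on
    the right coset of the translating element. This gives both \<open>orb_eq\<close> and the
    finiteness of the set of orbits.\<close>
  have orb_act: "orb (dom_act \<SS> g W) = (\<lambda>h. dom_act \<SS> h W) ` (N #> g)"
    if g: "g \<in> carrier G" and W: "W \<in> domains \<SS>" for g W
  proof -
    have "(\<lambda>h. dom_act \<SS> h W) ` (N #> g) = (\<lambda>k. dom_act \<SS> (k \<otimes> g) W) ` N"
      by (auto simp: r_coset_def)
    also have "\<dots> = orb (dom_act \<SS> g W)"
      unfolding orb_def using dom_act_mult N_carrier g W by (intro image_cong) auto
    finally show ?thesis
      by simp
  qed
  have orb_eq: "orb V = orb W" if W: "W \<in> domains \<SS>" and V: "V \<in> orb W" for V W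
  proof -
    obtain k where k: "k \<in> N" "V = dom_act \<SS> k W"
      using V by (auto simp: orb_def)
    have "orb V = (\<lambda>g. dom_act \<SS> g W) ` (N #> k)"
      using orb_act k W N_carrier by blast
    then show ?thesis
      using coset_join2[OF _ subN] k N_carrier by (simp add: orb_def)
  qed
  have orb_transverse: "transverse \<SS> A B"
    if W: "W \<in> domains \<SS>" and AB: "A \<in> orb W" "B \<in> orb W" "A \<noteq> B" for A B W
  proof -
    have B: "B \<in> domains \<SS>"
      using AB orb_dom[OF W] by blast
    have "A \<in> orb B"
      using orb_eq[OF W] AB by blast
    then obtain k where "k \<in> N" "A = dom_act \<SS> k B"
      by (auto simp: orb_def)
    then show ?thesis
      using dom_act_transverse north N_carrier AB(3) B by blast
  qed
  have fin_orbs: "finite (orb ` domains \<SS>)"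
  proof -
    obtain R where R: "finite R" "R \<subseteq> domains \<SS>"
      "\<And>W. W \<in> domains \<SS> \<Longrightarrow> \<exists>U\<in>R. \<exists>g\<in>carrier G. W = dom_act \<SS> g U"
      using orbit_representatives by blast
    \<comment> \<open>An \<open>N\<close>-orbit is determined by a coset of \<open>N\<close> and a
      representative of a \<open>G\<close>-orbit, and there are finitely many of each.\<close>
    have "orb ` domains \<SS> \<subseteq> (\<lambda>(C, U). (\<lambda>g. dom_act \<SS> g U) ` C) ` ((rcosets N) \<times> R)"
    proof clarify
      fix W assume "W \<in> domains \<SS>"
      then obtain U g where Ug: "U \<in> R" "g \<in> carrier G" "W = dom_act \<SS> g U"
        using R(3) by blast
      then have "orb W = (\<lambda>g. dom_act \<SS> g U) ` (N #> g)"
        using R(2) orb_act by blast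
      then show "orb W \<in> (\<lambda>(C, U). (\<lambda>g. dom_act \<SS> g U) ` C) ` ((rcosets N) \<times> R)"
        using Ug rcosetsI[OF subgroup.subset[OF subN]] by force
    qed
    then show ?thesis
      using fin R(1) by (meson finite_SigmaI finite_imageI finite_subset)
  qed
  \<comment> \<open>The orbits are numbered from 1, to match the index range in
    \<open>BBF_colouring\<close>.\<close>
  then obtain D where D: "bij_betw D {1..card (orb ` domains \<SS>)} (orb ` domains \<SS>)"
    using ex_bij_betw_nat_finite_1 by blast
  define n where "n = card (orb ` domains \<SS>)"
  have D_orb: "\<exists>W\<in>domains \<SS>. D i = orb W" if "i \<in> {1..n}" for i
    using bij_betwE[OF D] that unfolding n_def by blast
  have "BBF_colouring N \<SS> n D"
    unfolding BBF_colouring_def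
  proof (intro conjI ballI impI)
    have "D ` {1..n} = orb ` domains \<SS>"
      using D by (simp add: bij_betw_def n_def)
    then show "(\<Union>i\<in>{1..n}. D i) = domains \<SS>"
      using orb_self subsetD[OF orb_dom] by auto
    show "disjoint_family_on D {1..n}"
      unfolding disjoint_family_on_def
    proof (intro ballI impI)
      fix i j assume ij: "i \<in> {1..n}" "j \<in> {1..n}" "i \<noteq> j"
      then have "D i \<noteq> D j"
        using D by (auto simp: bij_betw_def n_def dest: inj_onD)
      then show "D i \<inter> D j = {}"
        using D_orb[OF ij(1)] D_orb[OF ij(2)] orb_eq by (metis disjoint_iff)
    qed
  next
    fix i g U assume i: "i \<in> {1..n}" and g: "g \<in> N" and U: "U \<in> D i"
    obtain W where "W \<in> domains \<SS>" "D i = orb W"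
      using D_orb i by blast
    then have "D i = orb U"
      using U orb_eq by blast
    then show "dom_act \<SS> g U \<in> D i"
      using g by (simp add: orb_def)
  next
    fix i U V assume "i \<in> {1..n}" "U \<in> D i" "V \<in> D i" "U \<noteq> V"
    then show "transverse \<SS> U V"
      using D_orb orb_transverse by metis
  qed
  then show ?thesis
    by (auto simp: admits_BBF_colouring_def)
qed

lemma ex_finite_index_BBF_colouring:
  assumes sep: "\<And>U. U \<in> domains \<SS> \<Longrightarrow> separable_subgroup (stabilizer G (dom_act \<SS>) U) G"
    and coc: "\<And>U. U \<in> domains \<SS> \<Longrightarrow>
      acts_cocompactly G (stabilizer G (dom_act \<SS>) U) (product_region G \<SS> E U)"
  shows "\<exists>K. finite_index_subgroup K G \<and> admits_BBF_colouring K \<SS>"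
proof -
  obtain R where R: "finite R" "R \<subseteq> domains \<SS>"
    "\<And>W. W \<in> domains \<SS> \<Longrightarrow> \<exists>U\<in>R. \<exists>g\<in>carrier G. W = dom_act \<SS> g U"
    using orbit_representatives by blast
  have "\<forall>U\<in>R. \<exists>\<F>. finite \<F> \<and> (\<forall>K\<in>\<F>. finite_index_subgroup K G) \<and>
      (\<forall>g\<in>carrier G \<inter> \<Inter>\<F>. \<not> orth \<SS> (dom_act \<SS> g U) U)"
    using finite_index_no_orthogonal_translate[OF _ sep coc] R(2) by (meson subsetD)
  then obtain \<F> where \<F>: "\<And>U. U \<in> R \<Longrightarrow> finite (\<F> U)"
    "\<And>U K. \<lbrakk>U \<in> R; K \<in> \<F> U\<rbrakk> \<Longrightarrow> finite_index_subgroup K G"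
    "\<And>U g. \<lbrakk>U \<in> R; g \<in> carrier G; g \<in> \<Inter>(\<F> U)\<rbrakk> \<Longrightarrow> \<not> orth \<SS> (dom_act \<SS> g U) U"
    by (metis IntI)
  have "finite (\<Union>(\<F> ` R))"
    using R(1) \<F>(1) by blast
  then obtain N where N: "N \<lhd> G" "finite_index_subgroup N G" "N \<subseteq> \<Inter>(\<Union>(\<F> ` R))"
    using finite_index_normal_subgroup[of "\<Union>(\<F> ` R)"] \<F>(2) by blast
  have "\<not> orth \<SS> (dom_act \<SS> k W) W" if k: "k \<in> N" and W: "W \<in> domains \<SS>" for k W
  proof -
    obtain U g where U: "U \<in> R" and g: "g \<in> carrier G" and W_eq: "W = dom_act \<SS> g U"
      using R(3)[OF W] by blast
    have U': "U \<in> domains \<SS>"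
      using U R(2) by blast
    have kG: "k \<in> carrier G"
      using k N(1) by (meson normal_imp_subgroup subgroup.mem_carrier)
    \<comment> \<open>Conjugation by \<open>g\<close> moves the question from \<open>W\<close> to
      its representative \<open>U\<close>, where \<open>\<F> U\<close> gives the answer; normality
      keeps \<open>k'\<close> in \<open>N\<close>.\<close>
    define k' where "k' = inv g \<otimes> k \<otimes> g"
    have "k' \<in> N"
      using normal.inv_op_closed1[OF N(1) g k] by (simp add: k'_def)
    moreover have "k' \<in> carrier G"
      using g kG by (simp add: k'_def)
    ultimately have "\<not> orth \<SS> (dom_act \<SS> k' U) U"
      using \<F>(3)[OF U] N(3) U by blast
    moreover have "dom_act \<SS> k' U = dom_act \<SS> (inv g) (dom_act \<SS> k W)"
      using g kG U' by (simp add: k'_def W_eq dom_act_mult dom_act_closed)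
    moreover have "dom_act \<SS> (inv g) W = U"
      using dom_act_inv[OF g U'] by (simp add: W_eq)
    ultimately show ?thesis
      using action_preserves[of "inv g" "dom_act \<SS> k W" W] g kG W dom_act_closed by auto
  qed
  then show ?thesis
    using N(2) BBF_colouring_by_orbits by blast
qed

end

theorem proposition3p2:
  fixes G :: "('g, 'x) monoid_scheme" and X :: "'g set"
    and \<SS> :: "('g, 'd, 'c) hh_structure" and E :: real
  assumes "hierarchically_hyperbolic_group G X \<SS> E"
    and "\<And>U. U \<in> domains \<SS> \<Longrightarrow> separable_subgroup (stabilizer G (dom_act \<SS>) U) G"
    and "\<And>U. U \<in> domains \<SS> \<Longrightarrow>
           acts_cocompactly G (stabilizer G (dom_act \<SS>) U) (product_region G \<SS> E U)"
  shows "\<exists>K. finite_index_subgroup K G \<and> admits_BBF_colouring K \<SS>"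
  using hierarchically_hyperbolic_group.ex_finite_index_BBF_colouring assms by blast

end
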